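(* Let $N>2$, $\alpha_0>0$, $\alpha_\mu<0$ for $0<\mu<N$, and let $\tau\in\{1,\dots,N-1\}$ be an index with $|\alpha_\tau|=\min_{0<\mu<N}|\alpha_\mu|$. (i) If $0<\alpha_0<|\alpha_\tau|$, then the state $\boldsymbol\Psi_{\uparrow\ldots\uparrow}$ has a lower energy than any other collinear state. (ii) If $|\alpha_\tau|<\alpha_0<\infty$, then the state $\boldsymbol\Psi_{\uparrow\ldots\downarrow}$ has a lower energy than any other collinear state, except those states $\boldsymbol\Psi_{\uparrow\ldots\downarrow}$ resulting from a different choice of the minimizing index $\tau$. (iii) If $\alpha_0=|\alpha_\tau|$, then the energies of $\boldsymbol\Psi_{\uparrow\ldots\uparrow}$ and $\boldsymbol\Psi_{\uparrow\ldots\downarrow}$ coincide and are lower than the energy of any other collinear state, except those states $\boldsymbol\Psi_{\uparrow\ldots\downarrow}$ resulting from a different choice of the minimizing index $\tau$.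
   Context: Planar configurations of $N$ unit spin vectors $\mathbf{s}_\mu=(\cos\phi_\mu,\sin\phi_\mu)$ (indices modulo $N$) are described, up to a global rotation, by the difference angles $\psi_\mu\equiv\phi_{\mu+1}-\phi_\mu$ modulo $2\pi$, $0\le\mu<N$, whose sum is a multiple of $2\pi$; hence a configuration is determined by $(\psi_1,\dots,\psi_{N-1})$ modulo $2\pi$. The energy $E=\sum_{\mu=0}^{N-1}\alpha_\mu\,\mathbf{s}_\mu\cdot\mathbf{s}_{\mu+1}$ equals $\alpha_0\cos\Psi-\sum_{\mu=1}^{N-1}|\alpha_\mu|\cos\psi_\mu$ with $\Psi=\sum_{\mu=1}^{N-1}\psi_\mu$. A collinear state is one in which all vectors are parallel or antiparallel, i.e. every $\psi_\mu$ is $0$ or $\pi$ modulo $2\pi$; states are identified up to global rotation. The state $\boldsymbol\Psi_{\uparrow\ldots\uparrow}$ has $\psi_\mu=0$ for all $0\le\mu<N$. The state $\boldsymbol\Psi_{\uparrow\ldots\downarrow}$ (depending on $\tau$) has $\psi_\mu=0$ for all $0<\mu<N$ with $\mu\ne\tau$, and $\psi_\tau=-\psi_0=\pi$. *)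

theory Defs
  imports "HOL-Analysis.Analysis" "HOL-Library.Real_Mod"
begin

text \<open>
  A planar configuration of \<open>N\<close> spins is given by its angles \<open>\<phi> \<mu>\<close> for \<open>\<mu> < N\<close>; the values of
  \<open>\<phi>\<close> at indices \<open>\<ge> N\<close> are irrelevant.
\<close>

definition spin :: "(nat \<Rightarrow> real) \<Rightarrow> nat \<Rightarrow> real ^ 2" where
  "spin \<phi> \<mu> = vector [cos (\<phi> \<mu>), sin (\<phi> \<mu>)]"

definition energy :: "nat \<Rightarrow> (nat \<Rightarrow> real) \<Rightarrow> (nat \<Rightarrow> real) \<Rightarrow> real" where
  "energy N \<alpha> \<phi> = (\<Sum>\<mu><N. \<alpha> \<mu> * (spin \<phi> \<mu> \<bullet> spin \<phi> ((\<mu> + 1) mod N)))"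

definition diff_angle :: "nat \<Rightarrow> (nat \<Rightarrow> real) \<Rightarrow> nat \<Rightarrow> real" where
  "diff_angle N \<phi> \<mu> = \<phi> ((\<mu> + 1) mod N) - \<phi> \<mu>"

text \<open>Equality of configurations up to a global rotation.\<close>

definition same_state :: "nat \<Rightarrow> (nat \<Rightarrow> real) \<Rightarrow> (nat \<Rightarrow> real) \<Rightarrow> bool" where
  "same_state N \<phi> \<phi>' \<longleftrightarrow> (\<exists>c. \<forall>\<mu><N. [\<phi>' \<mu> = \<phi> \<mu> + c] (rmod (2 * pi)))"

text \<open>
  For unit vectors, parallel and antiparallel mean equal and opposite. (The library's
  \<^const>\<open>collinear\<close> is about points on an affine line, which is a different notion.)
\<close>

definition collinear_state :: "nat \<Rightarrow> (nat \<Rightarrow> real) \<Rightarrow> bool" where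
  "collinear_state N \<phi> \<longleftrightarrow>
     (\<forall>\<mu><N. \<forall>\<nu><N. spin \<phi> \<mu> = spin \<phi> \<nu> \<or> spin \<phi> \<mu> = - spin \<phi> \<nu>)"

text \<open>
  The representative with \<open>\<phi> 0 = 0\<close> of the state with difference angles \<open>\<psi>\<close>. It has these
  difference angles only if they add up to a multiple of \<open>2 * pi\<close>.
\<close>

definition state_of :: "(nat \<Rightarrow> real) \<Rightarrow> nat \<Rightarrow> real" where
  "state_of \<psi> \<mu> = (\<Sum>\<nu><\<mu>. \<psi> \<nu>)"

definition up_up :: "nat \<Rightarrow> real" where
  "up_up = state_of (\<lambda>\<mu>. 0)"

definition up_down_angles :: "nat \<Rightarrow> nat \<Rightarrow> real" where
  "up_down_angles \<tau> \<mu> = (if \<mu> = 0 then - pi else if \<mu> = \<tau> then pi else 0)"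

definition up_down :: "nat \<Rightarrow> nat \<Rightarrow> real" where
  "up_down \<tau> = state_of (up_down_angles \<tau>)"

definition minimizing :: "nat \<Rightarrow> (nat \<Rightarrow> real) \<Rightarrow> nat \<Rightarrow> bool" where
  "minimizing N \<alpha> \<tau> \<longleftrightarrow>
     \<tau> \<in> {0<..<N} \<and> \<bar>\<alpha> \<tau>\<bar> = Min ((\<lambda>\<mu>. \<bar>\<alpha> \<mu>\<bar>) ` {0<..<N})"

lemma rcong_2pi_iff: "[x = y] (rmod (2 * pi)) \<longleftrightarrow> sin x = sin y \<and> cos x = cos y"
  using sin_cos_eq_iff[of y x] by (simp add: rcong_altdef mult.commute eq_commute)

lemma spin_eq_iff: "spin \<phi> \<mu> = spin \<phi>' \<nu> \<longleftrightarrow> [\<phi> \<mu> = \<phi>' \<nu>] (rmod (2 * pi))"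
  by (auto simp: spin_def vec_eq_iff forall_2 rcong_2pi_iff)

lemma diff_angle_state_of:
  assumes "\<mu> < N" and "[(\<Sum>\<nu><N. \<psi> \<nu>) = 0] (rmod (2 * pi))"
  shows "[diff_angle N (state_of \<psi>) \<mu> = \<psi> \<mu>] (rmod (2 * pi))"
proof (cases "\<mu> + 1 = N")
  case True
  then have N: "N = Suc \<mu>" by simp
  show ?thesis
    using assms(2) rcong_add_right_cancel[of "- (\<Sum>\<nu><\<mu>. \<psi> \<nu>)" "\<Sum>\<nu><\<mu>. \<psi> \<nu>" "\<psi> \<mu>" "2 * pi"]
    by (simp add: diff_angle_def state_of_def N rcong_sym_iff add.commute)
next
  case False
  then show ?thesis using assms(1) by (simp add: diff_angle_def state_of_def)
qed

lemma diff_angle_up_up: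
  assumes "\<mu> < N"
  shows "[diff_angle N up_up \<mu> = 0] (rmod (2 * pi))"
  using diff_angle_state_of[OF assms, of "\<lambda>_. 0"] by (simp add: up_up_def)

lemma diff_angle_up_down:
  assumes "\<mu> < N" "\<tau> \<in> {0<..<N}"
  shows "[diff_angle N (up_down \<tau>) \<mu> = up_down_angles \<tau> \<mu>] (rmod (2 * pi))"
proof -
  have "(\<Sum>\<nu><N. up_down_angles \<tau> \<nu>) =
      (\<Sum>\<nu><N. (if \<nu> = 0 then - pi else 0) + (if \<nu> = \<tau> then pi else 0))"
    using assms by (intro sum.cong) (auto simp: up_down_angles_def)
  also have "\<dots> = 0"
    using assms by (simp add: sum.distrib)
  finally show ?thesis
    using diff_angle_state_of[OF assms(1), of "up_down_angles \<tau>"] by (simp add: up_down_def)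
qed

lemma spin_opposite_iff: "spin \<phi> \<mu> = - spin \<phi> \<nu> \<longleftrightarrow> [\<phi> \<mu> - \<phi> \<nu> = pi] (rmod (2 * pi))"
proof -
  have "spin \<phi> \<mu> = - spin \<phi> \<nu> \<longleftrightarrow> sin (\<phi> \<mu>) = sin (\<phi> \<nu> + pi) \<and> cos (\<phi> \<mu>) = cos (\<phi> \<nu> + pi)"
    by (auto simp: spin_def vec_eq_iff forall_2)
  also have "\<dots> \<longleftrightarrow> [\<phi> \<mu> = \<phi> \<nu> + pi] (rmod (2 * pi))"
    by (simp add: rcong_2pi_iff)
  also have "\<dots> \<longleftrightarrow> [\<phi> \<mu> - \<phi> \<nu> = pi] (rmod (2 * pi))"
    by (simp add: rcong_altdef algebra_simps)
  finally show ?thesis .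
qed

lemma collinear_state_iff:
  "collinear_state N \<phi> \<longleftrightarrow>
     (\<forall>\<mu><N. [diff_angle N \<phi> \<mu> = 0] (rmod (2 * pi)) \<or> [diff_angle N \<phi> \<mu> = pi] (rmod (2 * pi)))"
    (is "_ \<longleftrightarrow> ?R")
proof -
  have step: "[diff_angle N \<phi> \<mu> = 0] (rmod (2 * pi)) \<or> [diff_angle N \<phi> \<mu> = pi] (rmod (2 * pi))
      \<longleftrightarrow> spin \<phi> ((\<mu> + 1) mod N) = spin \<phi> \<mu> \<or> spin \<phi> ((\<mu> + 1) mod N) = - spin \<phi> \<mu>" for \<mu>
    unfolding spin_eq_iff spin_opposite_iff diff_angle_def
    by (simp add: rcong_altdef algebra_simps)
  show ?thesis
  proof
    assume "collinear_state N \<phi>"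
    then show ?R
      unfolding step collinear_state_def by (metis mod_less_divisor not_less_zero not_gr_zero)
  next
    assume R: ?R
    have "\<mu> < N \<Longrightarrow> spin \<phi> \<mu> = spin \<phi> 0 \<or> spin \<phi> \<mu> = - spin \<phi> 0" for \<mu>
    proof (induction \<mu>)
      case (Suc \<mu>)
      then have "spin \<phi> (Suc \<mu>) = spin \<phi> \<mu> \<or> spin \<phi> (Suc \<mu>) = - spin \<phi> \<mu>"
        using R[unfolded step, rule_format, of \<mu>] by simp
      with Suc show ?case by auto
    qed simp
    then show "collinear_state N \<phi>"
      unfolding collinear_state_def by (metis minus_minus)
  qed
qed

end

theory Submission
  imports Defs
begin

text \<open>
  A collinear state is determined by its set of broken bonds, those with \<open>\<psi> \<mu> = \<pi>\<close>, and breaking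
  the bond \<open>\<mu>\<close> changes the energy of the fully aligned state by \<open>- 2 * \<alpha> \<mu>\<close>: it gains \<open>2 * \<alpha> 0\<close>
  for \<open>\<mu> = 0\<close> and costs \<open>2 * \<bar>\<alpha> \<mu>\<bar>\<close> otherwise. A state other than the aligned one breaks some bond
  \<open>\<mu> > 0\<close>, so it costs at least \<open>2 * \<bar>\<alpha> \<tau>\<bar> - 2 * \<alpha> 0\<close>, which \<open>up_down \<tau>\<close> attains; equality forces
  \<open>\<mu>\<close> to be minimizing and the only broken bond besides \<open>0\<close>.
\<close>

lemma energy_eq_sum_cos: "energy N \<alpha> \<phi> = (\<Sum>\<mu><N. \<alpha> \<mu> * cos (diff_angle N \<phi> \<mu>))"
  by (simp add: energy_def spin_def diff_angle_def inner_vec_def sum_2 cos_diff algebra_simps)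

lemma same_state_imp_energy_eq:
  assumes "same_state N \<phi> \<phi>'"
  shows "energy N \<alpha> \<phi> = energy N \<alpha> \<phi>'"
proof -
  obtain c where c: "[\<phi>' \<mu> = \<phi> \<mu> + c] (rmod (2 * pi))" if "\<mu> < N" for \<mu>
    using assms by (auto simp: same_state_def)
  have "cos (diff_angle N \<phi> \<mu>) = cos (diff_angle N \<phi>' \<mu>)" if "\<mu> < N" for \<mu>
  proof -
    have "[\<phi>' ((\<mu> + 1) mod N) - \<phi>' \<mu> = (\<phi> ((\<mu> + 1) mod N) + c) - (\<phi> \<mu> + c)] (rmod (2 * pi))"
      using that by (intro rcong_diff c) auto
    then show ?thesis
      by (simp add: diff_angle_def rcong_2pi_iff)
  qed
  then show ?thesis
    by (simp add: energy_eq_sum_cos)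
qed

text \<open>The bond \<open>0\<close> may be left out because the difference angles add up to \<open>0\<close>.\<close>

lemma same_stateI:
  assumes "N > 1"
    and "\<And>\<mu>. 0 < \<mu> \<Longrightarrow> \<mu> < N \<Longrightarrow> [diff_angle N \<phi>' \<mu> = diff_angle N \<phi> \<mu>] (rmod (2 * pi))"
  shows "same_state N \<phi> \<phi>'"
proof -
  \<comment> \<open>The rotation is read off at index \<open>1\<close>, since nothing is assumed
    about bond \<open>0\<close>, which joins \<open>0\<close> to \<open>1\<close>. The congruence
    spreads along the bonds \<open>1, ..., N - 1\<close>.\<close>
  define c where "c = \<phi>' 1 - \<phi> 1"
  have bond: "[\<phi>' ((\<mu> + 1) mod N) = \<phi> ((\<mu> + 1) mod N) + c] (rmod (2 * pi))"
    if "0 < \<mu>" "\<mu> < N" "[\<phi>' \<mu> = \<phi> \<mu> + c] (rmod (2 * pi))" for \<mu>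
    using rcong_add[OF assms(2)[OF that(1,2)] that(3)] by (simp add: diff_angle_def)
  have pos: "\<mu> < N \<Longrightarrow> [\<phi>' \<mu> = \<phi> \<mu> + c] (rmod (2 * pi))" if "1 \<le> \<mu>" for \<mu>
    using that
  proof (induction \<mu> rule: dec_induct)
    case base
    show ?case by (simp add: c_def)
  next
    case (step \<mu>)
    then show ?case using bond[of \<mu>] by simp
  qed
  \<comment> \<open>Index \<open>0\<close> is reached last, from \<open>N - 1\<close>: bond
    \<open>N - 1\<close> wraps around, as \<open>(N - 1 + 1) mod N = 0\<close>.\<close>
  moreover have "[\<phi>' 0 = \<phi> 0 + c] (rmod (2 * pi))"
    using bond[of "N - 1"] pos[of "N - 1"] assms(1) by simp
  ultimately show ?thesis
    unfolding same_state_def by (metis less_one not_le)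
qed

text \<open>Working modulo \<open>2 * pi\<close> makes the angle \<open>- pi\<close> of bond
  \<open>0\<close> in \<open>up_down\<close> count as broken too.\<close>

definition broken :: "nat \<Rightarrow> (nat \<Rightarrow> real) \<Rightarrow> nat set" where
  "broken N \<phi> = {\<mu>. \<mu> < N \<and> [diff_angle N \<phi> \<mu> = pi] (rmod (2 * pi))}"

lemma broken_up_up: "broken N up_up = {}"
  using diff_angle_up_up by (auto simp: broken_def rcong_2pi_iff)

lemma broken_up_down:
  assumes "\<tau> \<in> {0<..<N}"
  shows "broken N (up_down \<tau>) = {0, \<tau>}"
  using diff_angle_up_down[OF _ assms] assms
  by (auto simp: broken_def rcong_2pi_iff up_down_angles_def split: if_splits)

lemma collinear_up_up: "collinear_state N up_up"
  using diff_angle_up_up by (simp add: collinear_state_iff)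

lemma collinear_up_down:
  assumes "\<tau> \<in> {0<..<N}"
  shows "collinear_state N (up_down \<tau>)"
  using diff_angle_up_down[OF _ assms]
  by (auto simp: collinear_state_iff rcong_2pi_iff up_down_angles_def)

text \<open>The cosine is 1 on an intact bond and -1 on a broken one, so breaking a bond flips the
  sign of its term.\<close>

lemma energy_collinear:
  assumes "collinear_state N \<phi>"
  shows "energy N \<alpha> \<phi> = (\<Sum>\<mu><N. \<alpha> \<mu>) - 2 * (\<Sum>\<mu>\<in>broken N \<phi>. \<alpha> \<mu>)"
proof -
  have "energy N \<alpha> \<phi> = (\<Sum>\<mu><N. \<alpha> \<mu> - 2 * (if \<mu> \<in> broken N \<phi> then \<alpha> \<mu> else 0))"
    unfolding energy_eq_sum_cos
    using assms by (intro sum.cong) (auto simp: collinear_state_iff broken_def rcong_2pi_iff)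
  also have "\<dots> = (\<Sum>\<mu><N. \<alpha> \<mu>) - 2 * (\<Sum>\<mu>\<in>{..<N} \<inter> broken N \<phi>. \<alpha> \<mu>)"
    by (simp add: sum_subtractf sum.inter_restrict flip: sum_distrib_left)
  also have "{..<N} \<inter> broken N \<phi> = broken N \<phi>"
    by (auto simp: broken_def)
  finally show ?thesis .
qed

text \<open>Bond \<open>0\<close> is disregarded because the other difference angles already
  determine the state up to rotation.\<close>

lemma same_state_up_upI:
  assumes "N > 1" "collinear_state N \<phi>" "broken N \<phi> - {0} = {}"
  shows "same_state N \<phi> up_up"
proof (rule same_stateI[OF assms(1)])
  fix \<mu> assume "0 < \<mu>" "\<mu> < N"
  then show "[diff_angle N up_up \<mu> = diff_angle N \<phi> \<mu>] (rmod (2 * pi))"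
    using assms(2,3) diff_angle_up_up[of \<mu> N]
    by (auto simp: collinear_state_iff broken_def rcong_2pi_iff)
qed

lemma same_state_up_downI:
  assumes "N > 1" "collinear_state N \<phi>" "broken N \<phi> - {0} = {\<tau>}"
  shows "same_state N \<phi> (up_down \<tau>)"
proof (rule same_stateI[OF assms(1)])
  fix \<mu> assume \<mu>: "0 < \<mu>" "\<mu> < N"
  have "\<tau> \<in> broken N \<phi> - {0}"
    unfolding assms(3) by simp
  then have \<tau>: "\<tau> \<in> {0<..<N}"
    by (simp add: broken_def)
  have "\<mu> \<in> broken N \<phi> \<longleftrightarrow> \<mu> = \<tau>"
    using assms(3) \<mu>(1) by blast
  then have "[diff_angle N \<phi> \<mu> = up_down_angles \<tau> \<mu>] (rmod (2 * pi))"
    using assms(2) \<mu>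
    by (cases "\<mu> = \<tau>") (auto simp: collinear_state_iff broken_def up_down_angles_def)
  then show "[diff_angle N (up_down \<tau>) \<mu> = diff_angle N \<phi> \<mu>] (rmod (2 * pi))"
    using diff_angle_up_down[OF \<mu>(2) \<tau>] rcong_sym rcong_trans by blast
qed

lemma minimizing_iff:
  "minimizing N \<alpha> \<tau> \<longleftrightarrow> \<tau> \<in> {0<..<N} \<and> (\<forall>\<mu>\<in>{0<..<N}. \<bar>\<alpha> \<tau>\<bar> \<le> \<bar>\<alpha> \<mu>\<bar>)"
proof (cases "\<tau> \<in> {0<..<N}")
  case True
  then have "(\<lambda>\<mu>. \<bar>\<alpha> \<mu>\<bar>) ` {0<..<N} \<noteq> {}"
    by blast
  with True show ?thesis
    unfolding minimizing_def by (subst eq_Min_iff) auto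
qed (auto simp: minimizing_def)

text \<open>All terms of \<open>- sum \<alpha> D\<close> are positive, so the sum is at least any
  one of them, and each of them is at least \<open>\<bar>\<alpha> \<tau>\<bar>\<close>.\<close>

lemma sum_minimizing_le:
  assumes "\<And>\<mu>. 0 < \<mu> \<Longrightarrow> \<mu> < N \<Longrightarrow> \<alpha> \<mu> < (0::real)"
    and "minimizing N \<alpha> \<tau>" "D \<subseteq> {0<..<N}" "D \<noteq> {}"
  shows "\<bar>\<alpha> \<tau>\<bar> \<le> - sum \<alpha> D"
    and "\<bar>\<alpha> \<tau>\<bar> = - sum \<alpha> D \<Longrightarrow> \<exists>\<sigma>. D = {\<sigma>} \<and> minimizing N \<alpha> \<sigma>"
proof -
  obtain \<sigma> where \<sigma>: "\<sigma> \<in> D" using assms(4) by blast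
  have fin: "finite D" using assms(3) finite_subset by blast
  have neg: "\<alpha> \<mu> < 0" if "\<mu> \<in> D" for \<mu>
    using that assms(1,3) by auto
  have "\<bar>\<alpha> \<tau>\<bar> \<le> \<bar>\<alpha> \<sigma>\<bar>"
    using \<sigma> assms(2,3) by (auto simp: minimizing_iff)
  then have le: "\<bar>\<alpha> \<tau>\<bar> \<le> - \<alpha> \<sigma>"
    using neg[OF \<sigma>] by simp
  have split: "sum \<alpha> D = \<alpha> \<sigma> + sum \<alpha> (D - {\<sigma>})"
    using fin \<sigma> by (rule sum.remove)
  have rest: "sum \<alpha> (D - {\<sigma>}) \<le> 0"
    using neg by (intro sum_nonpos) (simp add: less_imp_le)
  show "\<bar>\<alpha> \<tau>\<bar> \<le> - sum \<alpha> D"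
    using le split rest by linarith
  show "\<exists>\<sigma>. D = {\<sigma>} \<and> minimizing N \<alpha> \<sigma>" if eq: "\<bar>\<alpha> \<tau>\<bar> = - sum \<alpha> D"
  proof (intro exI conjI)
    \<comment> \<open>Equality leaves no slack in either of the two estimates \<open>le\<close> and
      \<open>rest\<close>.\<close>
    have "sum \<alpha> (D - {\<sigma>}) = 0" and \<sigma>_eq: "\<bar>\<alpha> \<tau>\<bar> = - \<alpha> \<sigma>"
      using eq le split rest by linarith+
    \<comment> \<open>A nonempty sum of negative terms would be strictly negative.\<close>
    then have "D - {\<sigma>} = {}"
      using sum_strict_mono[of "D - {\<sigma>}" \<alpha> "\<lambda>_. 0"] fin neg by force
    then show "D = {\<sigma>}" using \<sigma> by blast
    show "minimizing N \<alpha> \<sigma>"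
      using \<sigma>_eq neg[OF \<sigma>] \<sigma> assms(2,3) by (auto simp: minimizing_iff)
  qed
qed

lemma energy_up_up: "energy N \<alpha> up_up = (\<Sum>\<mu><N. \<alpha> \<mu>)"
  by (simp add: energy_collinear collinear_up_up broken_up_up)

lemma energy_up_down:
  assumes "\<tau> \<in> {0<..<N}"
  shows "energy N \<alpha> (up_down \<tau>) = energy N \<alpha> up_up - 2 * \<alpha> 0 - 2 * \<alpha> \<tau>"
  using assms by (simp add: energy_collinear collinear_up_down broken_up_down energy_up_up)

text \<open>Breaking bond \<open>0\<close> can only lower the energy, so counting it as broken in
  every case gives a lower bound.\<close>

lemma energy_collinear_ge:
  assumes "\<alpha> 0 \<ge> 0" "collinear_state N \<phi>"
  shows "energy N \<alpha> up_up - 2 * \<alpha> 0 - 2 * sum \<alpha> (broken N \<phi> - {0}) \<le> energy N \<alpha> \<phi>"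
proof -
  have fin: "finite (broken N \<phi>)" by (simp add: broken_def)
  have "sum \<alpha> (broken N \<phi>) \<le> \<alpha> 0 + sum \<alpha> (broken N \<phi> - {0})"
    using assms(1) sum_diff1[OF fin, of \<alpha> 0] by (cases "0 \<in> broken N \<phi>") auto
  then show ?thesis
    by (simp add: energy_collinear[OF assms(2)] energy_up_up)
qed

theorem proposition2:
  fixes N \<tau> :: nat and \<alpha> :: "nat \<Rightarrow> real"
  assumes "N > 2"
    and "\<alpha> 0 > 0"
    and "\<And>\<mu>. 0 < \<mu> \<Longrightarrow> \<mu> < N \<Longrightarrow> \<alpha> \<mu> < 0"
    and "minimizing N \<alpha> \<tau>"
  shows "(\<alpha> 0 < \<bar>\<alpha> \<tau>\<bar> \<longrightarrow>
            (\<forall>\<phi>. collinear_state N \<phi> \<and> \<not> same_state N \<phi> up_up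
                  \<longrightarrow> energy N \<alpha> up_up < energy N \<alpha> \<phi>)) \<and>
         (\<bar>\<alpha> \<tau>\<bar> < \<alpha> 0 \<longrightarrow>
            (\<forall>\<phi>. collinear_state N \<phi> \<and> \<not> same_state N \<phi> (up_down \<tau>) \<and>
                  \<not> (\<exists>\<tau>'. minimizing N \<alpha> \<tau>' \<and> \<tau>' \<noteq> \<tau> \<and> same_state N \<phi> (up_down \<tau>'))
                  \<longrightarrow> energy N \<alpha> (up_down \<tau>) < energy N \<alpha> \<phi>)) \<and>
         (\<alpha> 0 = \<bar>\<alpha> \<tau>\<bar> \<longrightarrow>
            energy N \<alpha> up_up = energy N \<alpha> (up_down \<tau>) \<and>
            (\<forall>\<phi>. collinear_state N \<phi> \<and> \<not> same_state N \<phi> up_up \<and> \<not> same_state N \<phi> (up_down \<tau>) \<and>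
                  \<not> (\<exists>\<tau>'. minimizing N \<alpha> \<tau>' \<and> \<tau>' \<noteq> \<tau> \<and> same_state N \<phi> (up_down \<tau>'))
                  \<longrightarrow> energy N \<alpha> up_up < energy N \<alpha> \<phi> \<and>
                      energy N \<alpha> (up_down \<tau>) < energy N \<alpha> \<phi>))"
proof -
  have N: "N > 1" using assms(1) by simp
  have \<tau>: "\<tau> \<in> {0<..<N}" using assms(4) by (simp add: minimizing_def)
  have abs: "\<bar>\<alpha> \<tau>\<bar> = - \<alpha> \<tau>" using assms(3)[of \<tau>] \<tau> by simp
  note ud = energy_up_down[OF \<tau>, of \<alpha>]
  \<comment> \<open>One comparison serves all three regimes: among collinear states other than
    \<open>up_up\<close>, \<open>up_down \<tau>\<close> is a minimum. By \<open>ud\<close> and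
    \<open>abs\<close> its energy exceeds that of \<open>up_up\<close> by
    \<open>2 * (\<bar>\<alpha> \<tau>\<bar> - \<alpha> 0)\<close>, whose sign distinguishes the
    regimes.\<close>
  have ge: "energy N \<alpha> (up_down \<tau>) \<le> energy N \<alpha> \<phi>"
    and gt: "(\<forall>\<tau>'. minimizing N \<alpha> \<tau>' \<longrightarrow> \<not> same_state N \<phi> (up_down \<tau>')) \<Longrightarrow>
      energy N \<alpha> (up_down \<tau>) < energy N \<alpha> \<phi>"
    if coll: "collinear_state N \<phi>" and ne: "\<not> same_state N \<phi> up_up" for \<phi>
  proof -
    define D where "D = broken N \<phi> - {0}"
    have D: "D \<subseteq> {0<..<N}" "D \<noteq> {}"
      using same_state_up_upI[OF N coll] ne by (auto simp: D_def broken_def)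
    note sum = sum_minimizing_le[OF assms(3,4) D]
    note E = energy_collinear_ge[of \<alpha>, OF less_imp_le[OF assms(2)] coll, folded D_def]
    show "energy N \<alpha> (up_down \<tau>) \<le> energy N \<alpha> \<phi>"
      using sum(1) E ud abs by linarith
    assume other: "\<forall>\<tau>'. minimizing N \<alpha> \<tau>' \<longrightarrow> \<not> same_state N \<phi> (up_down \<tau>')"
    \<comment> \<open>Equality would make \<open>D\<close> a singleton \<open>{\<sigma>}\<close>
      with \<open>\<sigma>\<close> minimizing, and \<open>\<phi>\<close> would be the excluded state
      \<open>up_down \<sigma>\<close>.\<close>
    have "\<bar>\<alpha> \<tau>\<bar> \<noteq> - sum \<alpha> D"
      using sum(2) other same_state_up_downI[OF N coll] unfolding D_def by blast
    then show "energy N \<alpha> (up_down \<tau>) < energy N \<alpha> \<phi>"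
      using sum(1) E ud abs by linarith
  qed
  show ?thesis
  proof (intro conjI impI allI; (elim conjE)?)
    fix \<phi> assume "\<alpha> 0 < \<bar>\<alpha> \<tau>\<bar>" "collinear_state N \<phi>" "\<not> same_state N \<phi> up_up"
    then show "energy N \<alpha> up_up < energy N \<alpha> \<phi>"
      using ge[of \<phi>] ud abs by linarith
  next
    fix \<phi> assume *: "\<bar>\<alpha> \<tau>\<bar> < \<alpha> 0" "collinear_state N \<phi>" "\<not> same_state N \<phi> (up_down \<tau>)"
      "\<not> (\<exists>\<tau>'. minimizing N \<alpha> \<tau>' \<and> \<tau>' \<noteq> \<tau> \<and> same_state N \<phi> (up_down \<tau>'))"
    show "energy N \<alpha> (up_down \<tau>) < energy N \<alpha> \<phi>"
    \<comment> \<open>Here \<open>up_up\<close> is among the competitors, and \<open>gt\<close> does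
      not cover it; it loses because \<open>\<alpha> 0\<close> exceeds
      \<open>\<bar>\<alpha> \<tau>\<bar>\<close>.\<close>
    proof (cases "same_state N \<phi> up_up")
      case True
      then show ?thesis
        using *(1) ud abs same_state_imp_energy_eq[OF True, of \<alpha>] by linarith
    next
      case False
      \<comment> \<open>The exclusions of \<open>\<tau>\<close> and of every other minimizing
        \<open>\<tau>'\<close> together give the premise of \<open>gt\<close>.\<close>
      then show ?thesis using * gt by blast
    qed
  next
    assume "\<alpha> 0 = \<bar>\<alpha> \<tau>\<bar>"
    then show eq: "energy N \<alpha> up_up = energy N \<alpha> (up_down \<tau>)"
      using ud abs by linarith
    fix \<phi> assume *: "collinear_state N \<phi>" "\<not> same_state N \<phi> up_up"
      "\<not> same_state N \<phi> (up_down \<tau>)"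
      "\<not> (\<exists>\<tau>'. minimizing N \<alpha> \<tau>' \<and> \<tau>' \<noteq> \<tau> \<and> same_state N \<phi> (up_down \<tau>'))"
    then show "energy N \<alpha> (up_down \<tau>) < energy N \<alpha> \<phi>"
      using gt by blast
    then show "energy N \<alpha> up_up < energy N \<alpha> \<phi>"
      using eq by simp
  qed
qed

end
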